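(* For $k\geq 1$, let $$V_k(x_1,\dots,x_k)=\sum_{n_1,\dots,n_k\geq 1}\frac{\prod_{j=1}^{k-1}\min(n_j,n_{j+1})}{n_1^{x_1}\cdots n_k^{x_k}}$$ and $$P_k(x_1,\dots,x_k)=\sum_{n_1,\dots,n_k\geq 1}\frac{\sum_{v_1\mid n_1,\dots,v_k\mid n_k}\prod_{j=1}^{k-1}\min(v_j,v_{j+1})\min\!\big(\frac{n_j}{v_j},\frac{n_{j+1}}{v_{j+1}}\big)}{n_1^{x_1}\cdots n_k^{x_k}}.$$ Then $P_k(x_1,\dots,x_k)=\big(V_k(x_1,\dots,x_k)\big)^2$.
   Context: $V_k$ is the Dirichlet generating function of parallelogram polyominoes of width $k$ ($x_i$ marks the height of the $i$-th column), and $P_k$ is the Dirichlet generating function of parallelogram polycubes of width $k$ ($x_i$ marks the volume of the $i$-th plateau). Sums over $v_i\mid n_i$ run over positive divisors; empty products equal $1$. The identity is one of formal multiple Dirichlet series. *)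

theory Defs
  imports "HOL-Algebra.Ring" "HOL-Library.FuncSet"
begin

definition indices :: "nat \<Rightarrow> (nat \<Rightarrow> nat) set" where
  "indices k = {1..k} \<rightarrow>\<^sub>E {1..}"

definition factorizations :: "nat \<Rightarrow> (nat \<Rightarrow> nat) \<Rightarrow> ((nat \<Rightarrow> nat) \<times> (nat \<Rightarrow> nat)) set" where
  "factorizations k n =
     {(d, e). d \<in> indices k \<and> e \<in> indices k \<and> (\<forall>i\<in>{1..k}. d i * e i = n i)}"

text \<open>
  The ring of formal Dirichlet series in \<open>k\<close> variables. The series with general term
  \<open>a n / (n 1 powr x 1 * \<dots> * n k powr x k)\<close>, summed over all \<open>n \<in> indices k\<close>, is represented by
  its coefficient family \<open>a\<close>; multiplying two such series and collecting the terms with the same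
  denominator gives the multidimensional Dirichlet convolution.
\<close>

definition dirichlet_ring :: "nat \<Rightarrow> ((nat \<Rightarrow> nat) \<Rightarrow> int) ring" where
  "dirichlet_ring k =
    \<lparr>carrier = indices k \<rightarrow>\<^sub>E UNIV,
     mult = (\<lambda>f g. \<lambda>n\<in>indices k. \<Sum>(d, e)\<in>factorizations k n. f d * g e),
     one = (\<lambda>n\<in>indices k. if \<forall>i\<in>{1..k}. n i = 1 then 1 else 0),
     zero = (\<lambda>n\<in>indices k. 0),
     add = (\<lambda>f g. \<lambda>n\<in>indices k. f n + g n)\<rparr>"

definition V :: "nat \<Rightarrow> (nat \<Rightarrow> nat) \<Rightarrow> int" where
  "V k = (\<lambda>n\<in>indices k. \<Prod>j=1..<k. int (min (n j) (n (j + 1))))"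

text \<open>All divisions below are exact, since \<open>v i\<close> divides \<open>n i\<close>.\<close>

definition P :: "nat \<Rightarrow> (nat \<Rightarrow> nat) \<Rightarrow> int" where
  "P k = (\<lambda>n\<in>indices k. \<Sum>v\<in>(\<Pi>\<^sub>E i\<in>{1..k}. {d. d dvd n i}).
     \<Prod>j=1..<k. int (min (v j) (v (j + 1)) * min (n j div v j) (n (j + 1) div v (j + 1))))"

lemma V_closed: "V k \<in> carrier (dirichlet_ring k)"
  by (simp add: V_def dirichlet_ring_def)

lemma P_closed: "P k \<in> carrier (dirichlet_ring k)"
  by (simp add: P_def dirichlet_ring_def)

lemma factorizationsD:
  "p \<in> factorizations k n \<Longrightarrow> fst p \<in> indices k \<and> snd p \<in> indices k"
  by (auto simp: factorizations_def)

lemma finite_factorizations: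
  assumes "n \<in> indices k"
  shows "finite (factorizations k n)"
proof -
  let ?D = "\<Pi>\<^sub>E i\<in>{1..k}. {d. d dvd n i}"
  have "finite ?D"
  proof (rule finite_PiE)
    fix i assume "i \<in> {1..k}"
    then have "n i > 0" using assms by (force simp: indices_def PiE_iff)
    then show "finite {d. d dvd n i}" by simp
  qed simp
  moreover have "factorizations k n \<subseteq> ?D \<times> ?D"
  proof (rule subrelI)
    fix d e assume "(d, e) \<in> factorizations k n"
    then have de: "d \<in> extensional {1..k}" "e \<in> extensional {1..k}"
        "\<forall>i\<in>{1..k}. d i * e i = n i"
      by (auto simp: factorizations_def indices_def PiE_iff)
    then have "\<forall>i\<in>{1..k}. d i dvd n i \<and> e i dvd n i"
      by (metis dvd_triv_left dvd_triv_right)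
    with de show "(d, e) \<in> ?D \<times> ?D" by (auto simp: PiE_iff)
  qed
  ultimately show ?thesis by (meson finite_SigmaI finite_subset)
qed

definition index_mult :: "nat \<Rightarrow> (nat \<Rightarrow> nat) \<Rightarrow> (nat \<Rightarrow> nat) \<Rightarrow> nat \<Rightarrow> nat" where
  "index_mult k d e = (\<lambda>i\<in>{1..k}. d i * e i)"

lemma index_mult_closed:
  "d \<in> indices k \<Longrightarrow> e \<in> indices k \<Longrightarrow> index_mult k d e \<in> indices k"
  by (auto simp: indices_def index_mult_def PiE_iff Suc_le_eq)

lemma factorizations_iff:
  assumes "n \<in> indices k"
  shows "(d, e) \<in> factorizations k n \<longleftrightarrow>
    d \<in> indices k \<and> e \<in> indices k \<and> index_mult k d e = n"
proof -
  have "(\<forall>i\<in>{1..k}. d i * e i = n i) \<longleftrightarrow> index_mult k d e = n"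
    using assms
    by (auto simp: indices_def index_mult_def PiE_iff extensional_def fun_eq_iff)
  then show ?thesis by (auto simp: factorizations_def)
qed

lemma index_mult_assoc:
  "index_mult k (index_mult k a b) c = index_mult k a (index_mult k b c)"
  by (auto simp: index_mult_def fun_eq_iff)

lemma index_mult_commute: "index_mult k a b = index_mult k b a"
  by (auto simp: index_mult_def fun_eq_iff)

lemma index_mult_one: "a \<in> indices k \<Longrightarrow> index_mult k (\<lambda>i\<in>{1..k}. 1) a = a"
  by (auto simp: index_mult_def indices_def PiE_iff extensional_def fun_eq_iff)

lemma index_one_iff:
  "n \<in> indices k \<Longrightarrow> (\<forall>i\<in>{1..k}. n i = 1) \<longleftrightarrow> n = (\<lambda>i\<in>{1..k}. 1)"
  by (auto simp: indices_def PiE_iff extensional_def fun_eq_iff)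

lemma index_one_closed: "(\<lambda>i\<in>{1..k}. 1) \<in> indices k"
  by (auto simp: indices_def)

lemma cring_dirichlet_ring: "cring (dirichlet_ring k)"
proof (rule cringI)
  let ?R = "dirichlet_ring k"
  show "abelian_group ?R"
  proof (rule abelian_groupI)
    fix f assume "f \<in> carrier ?R"
    then show "\<exists>g\<in>carrier ?R. g \<oplus>\<^bsub>?R\<^esub> f = \<zero>\<^bsub>?R\<^esub>"
      by (intro bexI[of _ "\<lambda>n\<in>indices k. - f n"])
         (auto simp: dirichlet_ring_def restrict_def fun_eq_iff)
  qed (auto simp: dirichlet_ring_def restrict_def fun_eq_iff PiE_iff extensional_def)
  have comm: "f \<otimes>\<^bsub>?R\<^esub> g = g \<otimes>\<^bsub>?R\<^esub> f" for f g
  proof -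
    have "(\<Sum>(d, e)\<in>factorizations k n. f d * g e) = (\<Sum>(d, e)\<in>factorizations k n. g d * f e)" for n
      by (rule sum.reindex_bij_witness[where i = prod.swap and j = prod.swap])
         (auto simp: factorizations_def mult.commute)
    then show ?thesis by (simp add: dirichlet_ring_def)
  qed
  show "comm_monoid ?R"
  proof (rule comm_monoidI)
    fix f g h
    show "f \<otimes>\<^bsub>?R\<^esub> g \<otimes>\<^bsub>?R\<^esub> h = f \<otimes>\<^bsub>?R\<^esub> (g \<otimes>\<^bsub>?R\<^esub> h)"
    proof
      fix n
      show "(f \<otimes>\<^bsub>?R\<^esub> g \<otimes>\<^bsub>?R\<^esub> h) n = (f \<otimes>\<^bsub>?R\<^esub> (g \<otimes>\<^bsub>?R\<^esub> h)) n"
      proof (cases "n \<in> indices k")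
        case n: True
        let ?F = "factorizations k"
        have fin: "finite (?F n)" "\<And>p. p \<in> ?F n \<Longrightarrow> finite (?F (fst p)) \<and> finite (?F (snd p))"
          using n by (auto intro: finite_factorizations dest: factorizationsD)
        have "(f \<otimes>\<^bsub>?R\<^esub> g \<otimes>\<^bsub>?R\<^esub> h) n = (\<Sum>p\<in>?F n. \<Sum>q\<in>?F (fst p). f (fst q) * g (snd q) * h (snd p))"
          using n by (auto simp: dirichlet_ring_def case_prod_beta sum_distrib_right
              dest: factorizationsD intro!: sum.cong)
        also have "\<dots> = (\<Sum>(p, q)\<in>(SIGMA p:?F n. ?F (fst p)). f (fst q) * g (snd q) * h (snd p))"
          using fin by (subst sum.Sigma) auto
        also have "\<dots> = (\<Sum>(p, q)\<in>(SIGMA p:?F n. ?F (snd p)). f (fst p) * (g (fst q) * h (snd q)))"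
          by (rule sum.reindex_bij_witness[where
                j = "\<lambda>((d, c), (a, b)). ((a, index_mult k b c), (b, c))" and
                i = "\<lambda>((a, d), (b, c)). ((index_mult k a b, c), (a, b))"])
             (use n in \<open>auto simp: factorizations_iff index_mult_closed index_mult_assoc\<close>)
        also have "\<dots> = (\<Sum>p\<in>?F n. \<Sum>q\<in>?F (snd p). f (fst p) * (g (fst q) * h (snd q)))"
          using fin by (subst sum.Sigma) auto
        also have "\<dots> = (f \<otimes>\<^bsub>?R\<^esub> (g \<otimes>\<^bsub>?R\<^esub> h)) n"
          using n by (auto simp: dirichlet_ring_def case_prod_beta sum_distrib_left
              dest: factorizationsD intro!: sum.cong)
        finally show ?thesis .
      qed (simp add: dirichlet_ring_def)
    qed
  next
    fix f assume f: "f \<in> carrier ?R"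
    show "\<one>\<^bsub>?R\<^esub> \<otimes>\<^bsub>?R\<^esub> f = f"
    proof
      fix n
      show "(\<one>\<^bsub>?R\<^esub> \<otimes>\<^bsub>?R\<^esub> f) n = f n"
      proof (cases "n \<in> indices k")
        case n: True
        let ?u = "\<lambda>i\<in>{1..k}. 1 :: nat"
        have "(\<one>\<^bsub>?R\<^esub> \<otimes>\<^bsub>?R\<^esub> f) n = (\<Sum>(d, e)\<in>factorizations k n. (if d = ?u then 1 else 0) * f e)"
          unfolding dirichlet_ring_def using n
          by (auto simp: index_one_iff simp del: One_nat_def dest: factorizationsD intro!: sum.cong)
        also have "\<dots> = (\<Sum>(d, e)\<in>{(?u, n)}. (if d = ?u then 1 else 0) * f e)"
        proof (rule sum.mono_neutral_right)
          show "finite (factorizations k n)" using n by (rule finite_factorizations)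
          have "(?u, n) \<in> factorizations k n"
            using n index_mult_one[OF n] index_one_closed by (simp only: factorizations_iff)
          then show "{(?u, n)} \<subseteq> factorizations k n" by blast
          have "e = n" if "(?u, e) \<in> factorizations k n" for e
            using that index_mult_one[of e k] by (simp only: factorizations_iff[OF n])
          then have "d \<noteq> ?u" if "(d, e) \<in> factorizations k n - {(?u, n)}" for d e
            using that by blast
          then have ne: "fst p \<noteq> ?u" if "p \<in> factorizations k n - {(?u, n)}" for p
            using that by (metis prod.collapse)
          show "\<forall>p\<in>factorizations k n - {(?u, n)}.
              (case p of (d, e) \<Rightarrow> (if d = ?u then 1 else 0) * f e) = 0"
            unfolding case_prod_beta by (intro ballI) (simp only: ne if_False mult_zero_left)
        qed
        finally show ?thesis by simp
      qed (use f in \<open>auto simp: dirichlet_ring_def PiE_iff extensional_def\<close>)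
    qed
  next
    fix f g
    show "f \<otimes>\<^bsub>?R\<^esub> g \<in> carrier ?R" by (simp add: dirichlet_ring_def)
    show "f \<otimes>\<^bsub>?R\<^esub> g = g \<otimes>\<^bsub>?R\<^esub> f" by (rule comm)
  next
    show "\<one>\<^bsub>?R\<^esub> \<in> carrier ?R" by (simp add: dirichlet_ring_def)
  qed
  fix f g h
  show "(f \<oplus>\<^bsub>?R\<^esub> g) \<otimes>\<^bsub>?R\<^esub> h = f \<otimes>\<^bsub>?R\<^esub> h \<oplus>\<^bsub>?R\<^esub> g \<otimes>\<^bsub>?R\<^esub> h"
  proof
    fix n
    show "((f \<oplus>\<^bsub>?R\<^esub> g) \<otimes>\<^bsub>?R\<^esub> h) n = (f \<otimes>\<^bsub>?R\<^esub> h \<oplus>\<^bsub>?R\<^esub> g \<otimes>\<^bsub>?R\<^esub> h) n"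
    proof (cases "n \<in> indices k")
      case True
      have "((f \<oplus>\<^bsub>?R\<^esub> g) \<otimes>\<^bsub>?R\<^esub> h) n =
          (\<Sum>p\<in>factorizations k n. f (fst p) * h (snd p) + g (fst p) * h (snd p))"
        using True by (auto simp: dirichlet_ring_def case_prod_beta distrib_right
            dest: factorizationsD intro!: sum.cong)
      then show ?thesis
        using True by (simp add: dirichlet_ring_def case_prod_beta sum.distrib)
    qed (simp add: dirichlet_ring_def)
  qed
qed

end

theory Submission
  imports Defs
begin

text \<open>The weight of a column sequence in \<open>V\<close> is a product over adjacent pairs, so
  it is compatible with splitting each \<open>n i\<close> as \<open>v i * (n i div v i)\<close>: the
  summand of \<open>P\<close> at \<open>v\<close> is exactly the weight of \<open>v\<close> times
  the weight of the cofactor sequence. Choosing a divisor of each \<open>n i\<close> independently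
  is the same as choosing a factorization of the whole index \<open>n\<close>, which is what
  \<open>bij_betw_divisors_factorizations\<close> provides. Hence the divisor sum is the Dirichlet
  convolution of \<open>V\<close> with itself, coefficient by coefficient.\<close>

text \<open>The first factor determines the second because all entries of \<open>n\<close> are
  positive; the inverse map is the projection \<open>fst\<close>.\<close>

lemma bij_betw_divisors_factorizations:
  assumes n: "n \<in> indices k"
  shows "bij_betw (\<lambda>v. (v, \<lambda>i\<in>{1..k}. n i div v i))
    (\<Pi>\<^sub>E i\<in>{1..k}. {d. d dvd n i}) (factorizations k n)"
proof (rule bij_betw_byWitness[where f' = fst])
  have pos: "n i > 0" if "i \<in> {1..k}" for i
    using n that by (force simp: indices_def PiE_iff)
  let ?D = "\<Pi>\<^sub>E i\<in>{1..k}. {d. d dvd n i}"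
  show "\<forall>v\<in>?D. fst (v, \<lambda>i\<in>{1..k}. n i div v i) = v"
    by simp
  show "\<forall>p\<in>factorizations k n. (fst p, \<lambda>i\<in>{1..k}. n i div fst p i) = p"
  proof (intro ballI)
    fix p assume p: "p \<in> factorizations k n"
    obtain d e where p_eq: "p = (d, e)" by (cases p)
    with p have de: "(d, e) \<in> factorizations k n" by simp
    have "n i div d i = e i" if "i \<in> {1..k}" for i
    proof -
      have eq: "d i * e i = n i" using de that by (simp add: factorizations_def)
      \<comment> \<open>Cancelling \<open>d i\<close> in \<open>d i * e i div d i\<close> requires a
        nonzero divisor.\<close>
      with pos[OF that] have "d i \<noteq> 0" by (intro notI) simp
      then show ?thesis by (simp flip: eq)
    qed
    \<comment> \<open>Agreement on \<open>{1..k}\<close> gives equality of functions only because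
      \<open>e\<close> and the restricted quotient are both \<open>undefined\<close>
      elsewhere.\<close>
    moreover have "e \<in> extensional {1..k}"
      using de by (auto simp: factorizations_def indices_def PiE_iff)
    ultimately show "(fst p, \<lambda>i\<in>{1..k}. n i div fst p i) = p"
      by (auto simp: p_eq extensional_def fun_eq_iff)
  qed
  show "(\<lambda>v. (v, \<lambda>i\<in>{1..k}. n i div v i)) ` ?D \<subseteq> factorizations k n"
  proof (rule image_subsetI)
    fix v assume v: "v \<in> ?D"
    have "v i * (n i div v i) = n i" "v i \<ge> 1" "n i div v i \<ge> 1" if "i \<in> {1..k}" for i
    proof -
      have "v i dvd n i" using v that by (auto simp: PiE_iff)
      then show eq: "v i * (n i div v i) = n i" by simp
      \<comment> \<open>A positive product forces both factors to be positive, so both sequences are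
        valid indices.\<close>
      have "v i * (n i div v i) > 0" unfolding eq by (rule pos[OF that])
      then have "v i > 0 \<and> n i div v i > 0" by (simp only: nat_0_less_mult_iff)
      then show "v i \<ge> 1" "n i div v i \<ge> 1" by (simp_all only: Suc_le_eq One_nat_def)
    qed
    moreover have "v \<in> extensional {1..k}" using v by (simp add: PiE_iff)
    ultimately show "(v, \<lambda>i\<in>{1..k}. n i div v i) \<in> factorizations k n"
      by (simp add: factorizations_def indices_def PiE_iff)
  qed
  show "fst ` factorizations k n \<subseteq> ?D"
  proof (rule image_subsetI)
    fix p assume p: "p \<in> factorizations k n"
    have "fst p i dvd n i" if "i \<in> {1..k}" for i
    proof
      show "n i = fst p i * snd p i"
        using p that by (auto simp: factorizations_def)
    qed
    then show "fst p \<in> ?D"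
      using p by (auto simp: factorizations_def indices_def PiE_iff)
  qed
qed

theorem theorem2:
  fixes k :: nat
  assumes "k \<ge> 1"
  shows "P k = V k [^]\<^bsub>dirichlet_ring k\<^esub> (2::nat)"
proof
  fix n
  show "P k n = (V k [^]\<^bsub>dirichlet_ring k\<^esub> (2::nat)) n"
  proof (cases "n \<in> indices k")
    case n: True
    interpret cring "dirichlet_ring k" by (rule cring_dirichlet_ring)
    let ?w = "\<lambda>v. \<lambda>i\<in>{1..k}. n i div v i"
    have "P k n = (\<Sum>v\<in>(\<Pi>\<^sub>E i\<in>{1..k}. {d. d dvd n i}). case (v, ?w v) of (d, e) \<Rightarrow> V k d * V k e)"
    proof -
      have "(\<Prod>j=1..<k. int (min (v j) (v (j + 1)) * min (n j div v j) (n (j + 1) div v (j + 1))))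
          = V k v * V k (?w v)" if "v \<in> (\<Pi>\<^sub>E i\<in>{1..k}. {d. d dvd n i})" for v
      proof -
        \<comment> \<open>Both components must lie in \<open>indices k\<close>, since
          \<open>V k\<close> is given by its product formula only there.\<close>
        have "(v, ?w v) \<in> factorizations k n"
          using bij_betwE[OF bij_betw_divisors_factorizations[OF n]] that by blast
        then have "v \<in> indices k" "?w v \<in> indices k"
          by (auto dest: factorizationsD)
        then show ?thesis
          by (simp add: V_def flip: prod.distrib)
      qed
      then show ?thesis using n by (simp add: P_def)
    qed
    also have "\<dots> = (\<Sum>(d, e)\<in>factorizations k n. V k d * V k e)"
      by (rule sum.reindex_bij_betw[OF bij_betw_divisors_factorizations[OF n]])
    also have "\<dots> = (V k \<otimes>\<^bsub>dirichlet_ring k\<^esub> V k) n"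
      using n by (simp add: dirichlet_ring_def)
    also have "\<dots> = (V k [^]\<^bsub>dirichlet_ring k\<^esub> (2::nat)) n"
      \<comment> \<open>The power unfolds to \<open>\<one> \<otimes> V k \<otimes> V k\<close>;
        removing the unit needs \<open>V k\<close> in the carrier.\<close>
      by (simp add: numeral_2_eq_2 V_closed)
    finally show ?thesis .
  next
    \<comment> \<open>Outside \<open>indices k\<close> both sides are \<open>undefined\<close>, as
      \<open>P\<close> and the ring product are restricted functions.\<close>
    case False
    then show ?thesis
      by (simp add: P_def numeral_2_eq_2 dirichlet_ring_def nat_pow_def)
  qed
qed

end
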